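(* Let $m>0$ be a real number and let $f(x)=x^{-m}$ for all positive integers $x$. Let $S=\{x_1,x_2,\dots,x_n\}$ be a set of $n$ distinct positive integers. (a) For any such set $S$, $i_{+}([S]_f)=n$ and $i_{-}([S]_f)=i_{0}([S]_f)=0$. (b) If $S$ is factor-closed, then $i_{+}((S)_f)$ is the number of $x_i\in S$ such that $\omega(x_i)$ is even, $i_{-}((S)_f)$ is the number of $x_i\in S$ such that $\omega(x_i)$ is odd, and $i_{0}((S)_f)=0$.
   Context: For a set $S=\{x_1,\dots,x_n\}$ of distinct positive integers and a function $f$ on the positive integers, $(S)_f$ is the $n\times n$ matrix with $ij$ entry $f(\gcd(x_i,x_j))$ (the GCD matrix), and $[S]_f$ is the $n\times n$ matrix with $ij$ entry $f(\operatorname{lcm}(x_i,x_j))$ (the LCM matrix). $S$ is factor-closed if every positive divisor of every element of $S$ belongs to $S$. For a Hermitian matrix $H$, $i_{+}(H)$, $i_{-}(H)$, $i_0(H)$ denote the numbers of positive, negative and zero eigenvalues of $H$, respectively, counted with multiplicity. $\omega(x)$ is the number of distinct prime factors of $x$, with $\omega(1)=0$. *)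

theory Defs
  imports Complex_Main
    "HOL-Computational_Algebra.Primes"
    "Jordan_Normal_Form.Char_Poly"
begin

text \<open>A set \<open>{x\<^sub>1, \<dots>, x\<^sub>n}\<close> of distinct positive integers is given by a duplicate-free list
  of its elements, which fixes the enumeration used to index rows and columns.\<close>

definition gcd_matrix :: "(nat \<Rightarrow> 'a) \<Rightarrow> nat list \<Rightarrow> 'a mat" where
  "gcd_matrix f xs = mat (length xs) (length xs) (\<lambda>(i, j). f (gcd (xs ! i) (xs ! j)))"

definition lcm_matrix :: "(nat \<Rightarrow> 'a) \<Rightarrow> nat list \<Rightarrow> 'a mat" where
  "lcm_matrix f xs = mat (length xs) (length xs) (\<lambda>(i, j). f (lcm (xs ! i) (xs ! j)))"

definition factor_closed :: "nat set \<Rightarrow> bool" where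
  "factor_closed S \<longleftrightarrow> (\<forall>x\<in>S. \<forall>d. 0 < d \<and> d dvd x \<longrightarrow> d \<in> S)"

definition omega :: "nat \<Rightarrow> nat" where
  "omega x = card (prime_factors x)"

text \<open>The inertia of a Hermitian matrix. Multiplicity is algebraic, that is, the order of the
  eigenvalue as a root of the characteristic polynomial; for a Hermitian matrix it agrees with
  the geometric one, and all eigenvalues are real, so the condition \<open>a \<in> \<real>\<close> excludes nothing.\<close>

definition i_plus :: "complex mat \<Rightarrow> nat" where
  "i_plus H = (\<Sum>a | eigenvalue H a \<and> a \<in> \<real> \<and> Re a > 0. order a (char_poly H))"

definition i_minus :: "complex mat \<Rightarrow> nat" where
  "i_minus H = (\<Sum>a | eigenvalue H a \<and> a \<in> \<real> \<and> Re a < 0. order a (char_poly H))"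

definition i_zero :: "complex mat \<Rightarrow> nat" where
  "i_zero H = (\<Sum>a | eigenvalue H a \<and> a = 0. order a (char_poly H))"

end

theory Submission
  imports Defs "Jordan_Normal_Form.Jordan_Normal_Form_Existence"
begin

text \<open>
  Everything rests on a sum of squares. Let \<open>J s d = d\<^sup>s \<Prod>p|d. (1 - p\<^sup>-\<^sup>s)\<close> be the Jordan totient with
  a real exponent \<open>s\<close>, so that summing \<open>J s\<close> over the divisors of \<open>k\<close> gives \<open>k\<^sup>s\<close>
  (\<open>sum_jordan_totient_divisors\<close>). Since \<open>d\<close> divides \<open>gcd x y\<close> iff it divides both \<open>x\<close> and \<open>y\<close>, the
  Hermitian form with matrix \<open>gcd(x\<^sub>i, x\<^sub>j)\<^sup>s\<close> is
  \<open>\<Sum>d. J s d * |\<Sum>i with d | x\<^sub>i. w\<^sub>i|\<^sup>2\<close> (\<open>gcd_form_eq_sum_squares\<close>). The inner divisor sums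
  cannot all vanish unless \<open>w = 0\<close>: look at the largest \<open>x\<^sub>k\<close> with \<open>w\<^sub>k \<noteq> 0\<close>
  (\<open>divisor_sums_eq_0_imp\<close>).

  For the LCM matrix, \<open>lcm(a, b)\<^sup>-\<^sup>m = a\<^sup>-\<^sup>m b\<^sup>-\<^sup>m gcd(a, b)\<^sup>m\<close> turns the form into the one above with
  \<open>s = m > 0\<close>, where all \<open>J m d\<close> are positive; so it is positive definite. For the GCD matrix
  \<open>s = - m\<close>, and each factor \<open>1 - p\<^sup>m\<close> is negative, so \<open>J (- m) d\<close> has the sign \<open>(-1)\<^bsup>\<omega>(d)\<^esup>\<close>.
  If the set is factor-closed, then \<open>d\<close> ranges over the set itself, the divisor sums are \<open>n\<close>
  independent coordinates, and the form is diagonal in them with coefficients \<open>J (- m) x\<^sub>k\<close>.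

  What remains is Sylvester's law of inertia (\<open>sylvester_inertia\<close>): the numbers of eigenvalues of each
  sign, counted by their order in the characteristic polynomial, can be read off from any such
  coordinates. By the classical dimension count, two systems of coordinates that determine the signs of
  the same form agree in the number of coefficients of each sign (\<open>sign_coords_card_eq\<close>). One system comes
  from the form above, the other from the eigenvectors. The latter is obtained from the Jordan normal
  form, which is diagonal for a Hermitian matrix (\<open>hermitian_jordan_matrix_diagonal\<close>); although
  the eigenvectors that it supplies need not be orthonormal, they do determine the signs
  (\<open>sign_coords_diagonalization\<close>).
\<close>

section \<open>Jordan totients with a real exponent\<close>

text \<open>
  For \<open>s\<close> a positive integer this is the classical Jordan totient \<open>J\<^sub>s\<close>, and Euler's totient for \<open>s = 1\<close>.
\<close>

definition jordan_totient :: "real \<Rightarrow> nat \<Rightarrow> real" where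
  "jordan_totient s d = real d powr s * (\<Prod>p\<in>prime_factors d. 1 - real p powr (- s))"

lemma powr_prime_power_mult:
  fixes p e :: nat
  assumes "p > 0"
  shows "real (p ^ k * e) powr s = real p powr (real k * s) * real e powr s"
  using assms by (simp add: powr_mult powr_powr flip: powr_realpow)

lemma jordan_totient_prime_power_mult:
  assumes "prime p" "\<not> p dvd e" "e > 0"
  shows "jordan_totient s (p ^ Suc k * e)
           = (real p powr (real (Suc k) * s) - real p powr (real k * s)) * jordan_totient s e"
proof -
  have p: "real p > 0" using assms prime_gt_0_nat by simp
  have "prime_factors (p ^ Suc k) = {p}"
    unfolding prime_factorization_prime_power[OF assms(1)] by simp
  then have "prime_factors (p ^ Suc k * e) = insert p (prime_factors e)"
    using assms p prime_factors_product[of "p ^ Suc k" e] by simp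
  moreover have "p \<notin> prime_factors e" using assms by auto
  ultimately have "jordan_totient s (p ^ Suc k * e)
      = real p powr (real (Suc k) * s) * (1 - real p powr (- s)) * jordan_totient s e"
    using p assms(1,3) powr_prime_power_mult[of p "Suc k" e s]
    by (simp add: jordan_totient_def mult_ac del: power_Suc of_nat_mult of_nat_power of_nat_Suc)
  also have "real p powr (real (Suc k) * s) * (1 - real p powr (- s))
      = real p powr (real (Suc k) * s) - real p powr (real k * s)"
    by (simp add: right_diff_distrib powr_add[symmetric]) (simp add: algebra_simps)
  finally show ?thesis .
qed

text \<open>
  The divisors with the full power of \<open>p\<close> are split off, so that the divisor sum can be computed by
  induction.
\<close>

lemma divisors_prime_mult:
  fixes p e :: nat
  assumes "prime p" "\<not> p dvd e" "e > 0"
  shows "{d. d dvd p ^ Suc k * e} = {d. d dvd p ^ k * e} \<union> (*) (p ^ Suc k) ` {d. d dvd e}"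
proof (intro equalityI subsetI)
  fix d assume "d \<in> {d. d dvd p ^ Suc k * e}"
  then have "d dvd p ^ Suc k * e" by simp
  then obtain a b where ab: "d = a * b" "a dvd p ^ Suc k" "b dvd e"
    using division_decomp by blast
  then obtain i where i: "i \<le> Suc k" "a = p ^ i"
    using divides_primepow_nat[OF assms(1)] by blast
  show "d \<in> {d. d dvd p ^ k * e} \<union> (*) (p ^ Suc k) ` {d. d dvd e}"
  proof (cases "i = Suc k")
    case True
    then show ?thesis using ab i by auto
  next
    case False
    then have "i \<le> k" using i by simp
    then have "p ^ i * b dvd p ^ k * e" using ab by (intro mult_dvd_mono le_imp_power_dvd)
    then show ?thesis using ab i by simp
  qed
qed (auto intro: mult_dvd_mono dvd_mult2 simp: mult.assoc)

text \<open>
  Strong induction on \<open>n\<close>. With \<open>n = p\<^bsup>k+1\<^esup> e\<close> and \<open>p\<close> not dividing \<open>e\<close>, the divisors of \<open>p\<^sup>k e\<close>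
  contribute \<open>(p\<^sup>k e)\<^sup>s\<close>, and the others contribute \<open>(p\<^bsup>(k+1)s\<^esup> - p\<^bsup>ks\<^esup>) e\<^sup>s\<close>, so the sum telescopes.
\<close>

lemma sum_jordan_totient_divisors:
  assumes "n > 0"
  shows "(\<Sum>d | d dvd n. jordan_totient s d) = real n powr s"
  using assms
proof (induction n rule: less_induct)
  case (less n)
  show ?case
  proof (cases "n = 1")
    case True
    then show ?thesis by (simp add: jordan_totient_def)
  next
    case False
    then obtain p where p: "prime p" "p dvd n" using prime_factor_nat by blast
    define m where "m = multiplicity p n"
    obtain e where e: "n = p ^ m * e" "\<not> p dvd e"
      using multiplicity_decompose'[of n p] less.prems p m_def
      by (metis neq0_conv not_prime_unit)
    have "m \<noteq> 0" using e p by (metis mult_1 power_0)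
    then obtain k where k: "m = Suc k" using not0_implies_Suc by blast
    have pos: "e > 0" "p > 0" "p > 1" using less.prems e p prime_gt_0_nat prime_gt_1_nat by auto
    have less_n: "p ^ k * e < n" "e < n"
      using pos one_less_power[of p "Suc k"] by (auto simp: e(1) k)
    let ?D = "\<lambda>n. {d. d dvd n}" and ?J = "jordan_totient s"
    have disj: "?D (p ^ k * e) \<inter> (*) (p ^ Suc k) ` ?D e = {}"
    proof -
      have False if "p ^ Suc k * d dvd p ^ k * e" for d
      proof -
        have "p ^ k * p dvd p ^ k * e"
          using that by (metis dvd_mult_left mult.commute power_Suc)
        then show False using pos e by simp
      qed
      then show ?thesis by blast
    qed
    have fin: "finite (?D (p ^ k * e))" "finite (?D e)" using pos by auto
    have "(\<Sum>d\<in>?D n. ?J d) = (\<Sum>d\<in>?D (p ^ k * e). ?J d) + (\<Sum>d\<in>?D e. ?J (p ^ Suc k * d))"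
      using fin disj pos
      unfolding e(1) k divisors_prime_mult[OF p(1) e(2) pos(1)]
      by (subst sum.union_disjoint) (auto simp: sum.reindex inj_on_def)
    also have "(\<Sum>d\<in>?D e. ?J (p ^ Suc k * d))
        = (\<Sum>d\<in>?D e. (real p powr (real (Suc k) * s) - real p powr (real k * s)) * ?J d)"
    proof (rule sum.cong)
      fix d assume "d \<in> ?D e"
      then have "\<not> p dvd d" "d > 0" using e(2) pos dvd_trans by (auto intro: Nat.gr0I)
      then show "?J (p ^ Suc k * d) = (real p powr (real (Suc k) * s) - real p powr (real k * s)) * ?J d"
        using jordan_totient_prime_power_mult p(1) by blast
    qed simp
    also have "\<dots> = (real p powr (real (Suc k) * s) - real p powr (real k * s)) * real e powr s"
      using less.IH[OF less_n(2)] pos by (simp flip: sum_distrib_left)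
    also have "(\<Sum>d\<in>?D (p ^ k * e). ?J d) = real p powr (real k * s) * real e powr s"
      using less.IH[OF less_n(1)] pos powr_prime_power_mult[OF pos(2), of k e s] by simp
    finally have "(\<Sum>d\<in>?D n. ?J d) = real p powr (real (Suc k) * s) * real e powr s"
      by (simp add: algebra_simps)
    then show ?thesis
      using powr_prime_power_mult[OF pos(2), of "Suc k" e s] unfolding e(1) k by simp
  qed
qed

lemma jordan_totient_pos:
  assumes "s > 0" "d > 0"
  shows "jordan_totient s d > 0"
proof -
  have "1 - real p powr (- s) > 0" if "p \<in> prime_factors d" for p
  proof -
    have "real p > 1" using that prime_gt_1_nat by force
    then show ?thesis using assms by (simp add: powr_less_one)
  qed
  then show ?thesis unfolding jordan_totient_def using assms by (simp add: prod_pos)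
qed

lemma sgn_jordan_totient_neg:
  assumes "s < 0" "d > 0"
  shows "sgn (jordan_totient s d) = (- 1) ^ omega d"
proof -
  have "sgn (1 - real p powr (- s)) = - 1" if "p \<in> prime_factors d" for p
  proof -
    have "real p > 1" using that prime_gt_1_nat by force
    then have "real p powr (- s) > 1" using assms powr_less_mono[of 0 "- s" "real p"] by simp
    then show ?thesis by simp
  qed
  then have "(\<Prod>p\<in>prime_factors d. sgn (1 - real p powr (- s))) = (- 1) ^ omega d"
    by (simp add: omega_def)
  moreover have "sgn (\<Prod>p\<in>P. g p) = (\<Prod>p\<in>P. sgn (g p :: real))" for g and P :: "nat set"
    by (induction P rule: infinite_finite_induct) (auto simp: sgn_mult)
  ultimately show ?thesis
    using assms by (simp add: jordan_totient_def sgn_mult)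
qed

section \<open>GCD forms as sums of squares\<close>

text \<open>
  The incidence matrix of divisibility is triangular with unit diagonal when the elements are ordered
  by size. Concretely, at the largest \<open>xs ! k\<close> with \<open>w k \<noteq> 0\<close>, the divisor sum reduces to \<open>w k\<close>.
\<close>

lemma divisor_sums_eq_0_imp:
  fixes w :: "nat \<Rightarrow> 'a :: comm_monoid_add"
  assumes "distinct xs" "\<forall>x\<in>set xs. x > (0::nat)"
    and zero: "\<And>k. k < length xs \<Longrightarrow> (\<Sum>i | i < length xs \<and> xs ! k dvd xs ! i. w i) = 0"
    and "i < length xs"
  shows "w i = 0"
proof (rule ccontr)
  assume "w i \<noteq> 0"
  let ?I = "{i. i < length xs \<and> w i \<noteq> 0}"
  have "finite ?I" "?I \<noteq> {}" using \<open>w i \<noteq> 0\<close> assms(4) by auto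
  then have "Max ((!) xs ` ?I) \<in> (!) xs ` ?I" by (intro Max_in) auto
  then obtain k where k: "k \<in> ?I" "Max ((!) xs ` ?I) = xs ! k" by auto
  have max: "xs ! i \<le> xs ! k" if "i \<in> ?I" for i
    using that \<open>finite ?I\<close> by (subst k(2)[symmetric]) (intro Max_ge, auto)
  have "(\<Sum>i | i < length xs \<and> xs ! k dvd xs ! i. w i) = sum w {k}"
  proof (rule sum.mono_neutral_right)
    show "\<forall>i\<in>{i. i < length xs \<and> xs ! k dvd xs ! i} - {k}. w i = 0"
    proof (rule ballI, rule ccontr)
      fix i assume i: "i \<in> {i. i < length xs \<and> xs ! k dvd xs ! i} - {k}" "w i \<noteq> 0"
      then have "xs ! k dvd xs ! i" "xs ! i \<in> set xs" by simp_all
      then have "xs ! k \<le> xs ! i" using assms(2) dvd_imp_le by blast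
      moreover have "xs ! i \<le> xs ! k" using i by (intro max) auto
      ultimately have "xs ! i = xs ! k" by (rule le_antisym[rotated])
      then show False using i(1) k(1) assms(1) by (simp add: nth_eq_iff_index_eq)
    qed
  qed (use k in auto)
  then show False using zero[of k] k by simp
qed

text \<open>
  The condition that \<open>d\<close> divides the gcd separates into a condition on \<open>i\<close> and one on \<open>j\<close>, so that, for each
  \<open>d\<close>, the double sum factors. Any finite \<open>D\<close> with all the divisors will do: this allows the set itself
  when it is factor-closed, and the set of all divisors otherwise.
\<close>

lemma gcd_form_eq_sum_squares:
  fixes h :: "nat \<Rightarrow> real" and w :: "nat \<Rightarrow> complex"
  assumes "finite D" and D: "\<And>x d. x \<in> set xs \<Longrightarrow> d dvd x \<Longrightarrow> d \<in> D"
  shows "(\<Sum>i<length xs. \<Sum>j<length xs.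
            of_real (\<Sum>d | d dvd gcd (xs ! i) (xs ! j). h d) * w j * cnj (w i))
         = of_real (\<Sum>d\<in>D. h d * (cmod (\<Sum>i | i < length xs \<and> d dvd xs ! i. w i))\<^sup>2)"
proof -
  let ?n = "length xs"
  let ?e = "\<lambda>d i. if d dvd xs ! i then w i else 0"
  have inner: "of_real (\<Sum>d | d dvd gcd (xs ! i) (xs ! j). h d) * w j * cnj (w i)
      = (\<Sum>d\<in>D. of_real (h d) * ?e d j * cnj (?e d i))" if "i < ?n" "j < ?n" for i j
  proof -
    have "{d. d dvd gcd (xs ! i) (xs ! j)} = {d\<in>D. d dvd xs ! i \<and> d dvd xs ! j}"
      using D[of "xs ! i"] that by auto
    then have "of_real (\<Sum>d | d dvd gcd (xs ! i) (xs ! j). h d) * w j * cnj (w i)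
        = (\<Sum>d\<in>D. if d dvd xs ! i \<and> d dvd xs ! j then of_real (h d) * w j * cnj (w i) else 0)"
      using assms(1) by (simp add: sum_distrib_right flip: sum.inter_filter)
    then show ?thesis by (auto intro!: sum.cong simp: if_distrib)
  qed
  have "(\<Sum>i<?n. \<Sum>j<?n. of_real (\<Sum>d | d dvd gcd (xs ! i) (xs ! j). h d) * w j * cnj (w i))
      = (\<Sum>i<?n. \<Sum>j<?n. \<Sum>d\<in>D. of_real (h d) * ?e d j * cnj (?e d i))"
    by (intro sum.cong refl inner) auto
  also have "\<dots> = (\<Sum>i<?n. \<Sum>d\<in>D. \<Sum>j<?n. of_real (h d) * ?e d j * cnj (?e d i))"
    by (intro sum.cong refl sum.swap)
  also have "\<dots> = (\<Sum>d\<in>D. \<Sum>i<?n. \<Sum>j<?n. of_real (h d) * ?e d j * cnj (?e d i))"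
    by (rule sum.swap)
  also have "\<dots> = (\<Sum>d\<in>D. of_real (h d) * ((\<Sum>j<?n. ?e d j) * cnj (\<Sum>i<?n. ?e d i)))"
  proof (rule sum.cong[OF refl])
    fix d
    have "(\<Sum>i<?n. \<Sum>j<?n. of_real (h d) * ?e d j * cnj (?e d i))
        = of_real (h d) * (\<Sum>i<?n. \<Sum>j<?n. cnj (?e d i) * ?e d j)"
      by (simp add: sum_distrib_left mult_ac del: if_split)
    also have "(\<Sum>i<?n. \<Sum>j<?n. cnj (?e d i) * ?e d j) = (\<Sum>i<?n. cnj (?e d i)) * (\<Sum>j<?n. ?e d j)"
      by (rule sum_product[symmetric])
    also have "\<dots> = (\<Sum>j<?n. ?e d j) * cnj (\<Sum>i<?n. ?e d i)"
      by (simp only: cnj_sum mult.commute)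
    finally show "(\<Sum>i<?n. \<Sum>j<?n. of_real (h d) * ?e d j * cnj (?e d i))
        = of_real (h d) * ((\<Sum>j<?n. ?e d j) * cnj (\<Sum>i<?n. ?e d i))" .
  qed
  also have "\<dots> = of_real (\<Sum>d\<in>D. h d * (cmod (\<Sum>i<?n. ?e d i))\<^sup>2)"
    by (simp only: complex_norm_square[symmetric] of_real_sum of_real_mult of_real_power)
  finally show ?thesis
    by (simp add: sum.inter_filter[symmetric])
qed

section \<open>Coordinates that determine the signs of a form\<close>

definition hermitian_mat :: "complex mat \<Rightarrow> bool" where
  "hermitian_mat A \<longleftrightarrow> (\<forall>i<dim_row A. \<forall>j<dim_row A. A $$ (j, i) = cnj (A $$ (i, j)))"

definition hermitian_form :: "complex mat \<Rightarrow> complex vec \<Rightarrow> real" where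
  "hermitian_form A v = Re ((A *\<^sub>v v) \<bullet>c v)"

text \<open>
  The signs of \<open>q\<close> are determined by the signs \<open>d i\<close> of those coordinates \<open>(X v)\<^sub>i\<close> that do not
  vanish at \<open>v\<close>. This is exactly what Sylvester's dimension count uses of a diagonal form. It is weaker
  than \<open>q v = \<Sum>i. d i * |(X v)\<^sub>i|\<^sup>2\<close>, and so it applies as well to eigenvectors that are not orthonormal
  and to definite forms. The factor \<open>\<sigma>\<close> makes the notion symmetric under a change of sign.
\<close>

definition sign_coords ::
    "nat \<Rightarrow> (complex vec \<Rightarrow> real) \<Rightarrow> complex mat \<Rightarrow> (nat \<Rightarrow> real) \<Rightarrow> bool" where
  "sign_coords n q X d \<longleftrightarrow> X \<in> carrier_mat n n \<and>
     (\<forall>\<sigma>\<in>{1, - 1}. \<forall>v\<in>carrier_vec n. v \<noteq> 0\<^sub>v n \<longrightarrow>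
        ((\<forall>i<n. (X *\<^sub>v v) $ i \<noteq> 0 \<longrightarrow> \<sigma> * d i > 0) \<longrightarrow> \<sigma> * q v > 0) \<and>
        ((\<forall>i<n. (X *\<^sub>v v) $ i \<noteq> 0 \<longrightarrow> \<sigma> * d i \<ge> 0) \<longrightarrow> \<sigma> * q v \<ge> 0))"

text \<open>
  Fewer than \<open>n\<close> linear equations in \<open>n\<close> unknowns have a nonzero solution: padded by zero rows, the
  equations form a singular square matrix.
\<close>

lemma exists_common_kernel_vec:
  fixes X Y :: "'a :: field mat"
  assumes X: "X \<in> carrier_mat n n" and Y: "Y \<in> carrier_mat n n"
    and I: "I \<subseteq> {..<n}" and J: "J \<subseteq> {..<n}" and card: "card I + card J < n"
  obtains v where "v \<in> carrier_vec n" "v \<noteq> 0\<^sub>v n"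
    "\<And>i. i \<in> I \<Longrightarrow> (X *\<^sub>v v) $ i = 0" "\<And>j. j \<in> J \<Longrightarrow> (Y *\<^sub>v v) $ j = 0"
proof -
  have fin: "finite I" "finite J" using I J finite_subset by auto
  define rs where "rs = map (row X) (sorted_list_of_set I) @ map (row Y) (sorted_list_of_set J)"
  \<comment> \<open>Fewer than \<open>n\<close> equations leave room for a zero row, which makes \<open>W\<close> singular.\<close>
  define W where "W = mat\<^sub>r n n (\<lambda>i. if i = n - 1 then 0\<^sub>v n else if i < length rs then rs ! i else 0\<^sub>v n)"
  have len: "length rs = card I + card J" by (simp add: rs_def)
  have rs: "set rs \<subseteq> carrier_vec n" using X Y fin by (auto simp: rs_def)
  have W: "W \<in> carrier_mat n n" by (simp add: W_def)
  have "det W = 0"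
    unfolding W_def using card rs nth_mem by (intro det_row_0) (auto simp: subset_iff)
  then obtain v where v: "v \<in> carrier_vec n" "v \<noteq> 0\<^sub>v n" "W *\<^sub>v v = 0\<^sub>v n"
    using det_0_iff_vec_prod_zero[OF W] by blast
  have zero: "r \<bullet> v = 0" if "r \<in> set rs" for r
  proof -
    from that obtain k where k: "k < length rs" "r = rs ! k" unfolding in_set_conv_nth by blast
    have kn: "k < n" "k \<noteq> n - 1" using k(1) len card by linarith+
    have "dim_vec (rs ! k) = n" using rs nth_mem[OF k(1)] carrier_vecD by blast
    then have "row W k = r" using k kn unfolding W_def by (subst row_mat_of_row_fun) simp_all
    moreover have "(W *\<^sub>v v) $ k = row W k \<bullet> v" using kn(1) W by simp
    ultimately show ?thesis using v(3) kn(1) by simp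
  qed
  show thesis
  proof
    show "(X *\<^sub>v v) $ i = 0" if "i \<in> I" for i
      using zero[of "row X i"] that fin I X by (auto simp: rs_def)
    show "(Y *\<^sub>v v) $ j = 0" if "j \<in> J" for j
      using zero[of "row Y j"] that fin J Y by (auto simp: rs_def)
  qed (use v in auto)
qed

text \<open>
  Otherwise the equations \<open>(X v)\<^sub>i = 0\<close> for \<open>\<sigma> * d i \<le> 0\<close> and \<open>(Y v)\<^sub>j = 0\<close> for \<open>\<sigma> * e j > 0\<close> would
  number less than \<open>n\<close>, and a common nonzero solution \<open>v\<close> would have both \<open>\<sigma> * q v > 0\<close> and
  \<open>\<sigma> * q v \<le> 0\<close>.
\<close>

lemma sign_coords_card_le:
  assumes d: "sign_coords n q X d" and e: "sign_coords n q Y e" and \<sigma>: "\<sigma> \<in> {1, - 1}"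
  shows "card {i. i < n \<and> \<sigma> * d i > 0} \<le> card {i. i < n \<and> \<sigma> * e i > 0}"
proof (rule ccontr)
  assume *: "\<not> ?thesis"
  let ?I = "{i. i < n \<and> \<not> \<sigma> * d i > 0}" and ?J = "{i. i < n \<and> \<sigma> * e i > 0}"
  have "card {i. i < n \<and> \<sigma> * d i > 0} + card ?I = card ({i. i < n \<and> \<sigma> * d i > 0} \<union> ?I)"
    by (rule card_Un_disjoint[symmetric]) auto
  also have "{i. i < n \<and> \<sigma> * d i > 0} \<union> ?I = {..<n}" by auto
  finally have "card ?I + card ?J < n" using * by simp
  then obtain v where v: "v \<in> carrier_vec n" "v \<noteq> 0\<^sub>v n"
    "\<And>i. i \<in> ?I \<Longrightarrow> (X *\<^sub>v v) $ i = 0" "\<And>j. j \<in> ?J \<Longrightarrow> (Y *\<^sub>v v) $ j = 0"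
    using exists_common_kernel_vec[of X n Y ?I ?J] d e unfolding sign_coords_def by blast
  have "\<sigma> * q v > 0" using d \<sigma> v unfolding sign_coords_def by blast
  moreover have "(- \<sigma>) * q v \<ge> 0"
  proof -
    have "- \<sigma> \<in> {1, - 1}" using \<sigma> by auto
    moreover have "\<forall>i<n. (Y *\<^sub>v v) $ i \<noteq> 0 \<longrightarrow> (- \<sigma>) * e i \<ge> 0" using v(4) by force
    ultimately show ?thesis using e v(1,2) unfolding sign_coords_def by blast
  qed
  ultimately show False by simp
qed

lemma sign_coords_card_eq:
  assumes "sign_coords n q X d" "sign_coords n q Y e"
  shows "card {i. i < n \<and> d i > 0} = card {i. i < n \<and> e i > 0}"
    and "card {i. i < n \<and> d i < 0} = card {i. i < n \<and> e i < 0}"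
    and "card {i. i < n \<and> d i = 0} = card {i. i < n \<and> e i = 0}"
proof -
  show pos: "card {i. i < n \<and> d i > 0} = card {i. i < n \<and> e i > 0}"
    using sign_coords_card_le[OF assms, of 1] sign_coords_card_le[OF assms(2,1), of 1] by simp
  show neg: "card {i. i < n \<and> d i < 0} = card {i. i < n \<and> e i < 0}"
    using sign_coords_card_le[OF assms, of "- 1"] sign_coords_card_le[OF assms(2,1), of "- 1"]
    by simp
  have "card {i. i < n \<and> d i > 0} + card {i. i < n \<and> d i < 0} + card {i. i < n \<and> d i = 0} = n"
    for d :: "nat \<Rightarrow> real"
  proof -
    have "card ({i. i < n \<and> d i > 0} \<union> {i. i < n \<and> d i < 0} \<union> {i. i < n \<and> d i = 0})
       = card {i. i < n \<and> d i > 0} + card {i. i < n \<and> d i < 0} + card {i. i < n \<and> d i = 0}"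
      by (subst card_Un_disjoint; (subst card_Un_disjoint)?) auto
    moreover have "{i. i < n \<and> d i > 0} \<union> {i. i < n \<and> d i < 0} \<union> {i. i < n \<and> d i = 0} = {..<n}"
      by auto
    ultimately show ?thesis by simp
  qed
  from this[of d] this[of e] pos neg
  show "card {i. i < n \<and> d i = 0} = card {i. i < n \<and> e i = 0}" by linarith
qed

lemma sign_coords_pos:
  assumes "\<And>v. v \<in> carrier_vec n \<Longrightarrow> v \<noteq> 0\<^sub>v n \<Longrightarrow> q v > 0"
  shows "sign_coords n q (1\<^sub>m n) (\<lambda>_. 1)"
  unfolding sign_coords_def
proof (intro conjI ballI impI)
  fix \<sigma> :: real and v :: "complex vec"
  assume \<sigma>: "\<sigma> \<in> {1, - 1}" and v: "v \<in> carrier_vec n" "v \<noteq> 0\<^sub>v n"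
  have "\<exists>i<n. v $ i \<noteq> 0" using v by (metis carrier_vecD eq_vecI index_zero_vec)
  then have *: "\<sigma> \<ge> 0" if "\<forall>i<n. (1\<^sub>m n *\<^sub>v v) $ i \<noteq> 0 \<longrightarrow> \<sigma> * 1 \<ge> 0"
    using that v by auto
  show "\<sigma> * q v \<ge> 0" if "\<forall>i<n. (1\<^sub>m n *\<^sub>v v) $ i \<noteq> 0 \<longrightarrow> \<sigma> * 1 \<ge> 0"
    using *[OF that] \<sigma> assms[OF v] by auto
  show "\<sigma> * q v > 0" if "\<forall>i<n. (1\<^sub>m n *\<^sub>v v) $ i \<noteq> 0 \<longrightarrow> \<sigma> * 1 > 0"
    using * that \<sigma> assms[OF v] by force
qed simp

lemma sign_coords_sum_squares:
  assumes Y: "Y \<in> carrier_mat n n"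
    and inj: "\<And>v. v \<in> carrier_vec n \<Longrightarrow> Y *\<^sub>v v = 0\<^sub>v n \<Longrightarrow> v = 0\<^sub>v n"
    and q: "\<And>v. v \<in> carrier_vec n \<Longrightarrow> q v = (\<Sum>i<n. d i * (cmod ((Y *\<^sub>v v) $ i))\<^sup>2)"
  shows "sign_coords n q Y d"
  unfolding sign_coords_def
proof (intro conjI ballI impI)
  fix \<sigma> :: real and v :: "complex vec"
  assume v: "v \<in> carrier_vec n" "v \<noteq> 0\<^sub>v n"
  have eq: "\<sigma> * q v = (\<Sum>i<n. \<sigma> * d i * (cmod ((Y *\<^sub>v v) $ i))\<^sup>2)"
    by (simp add: q[OF v(1)] sum_distrib_left mult_ac)
  show "\<sigma> * q v \<ge> 0" if "\<forall>i<n. (Y *\<^sub>v v) $ i \<noteq> 0 \<longrightarrow> \<sigma> * d i \<ge> 0"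
    unfolding eq
  proof (rule sum_nonneg)
    fix i assume "i \<in> {..<n}"
    then show "\<sigma> * d i * (cmod ((Y *\<^sub>v v) $ i))\<^sup>2 \<ge> 0"
      using that by (cases "(Y *\<^sub>v v) $ i = 0") auto
  qed
  assume pos: "\<forall>i<n. (Y *\<^sub>v v) $ i \<noteq> 0 \<longrightarrow> \<sigma> * d i > 0"
  have "Y *\<^sub>v v \<noteq> 0\<^sub>v n" using inj v by blast
  then obtain k where k: "k < n" "(Y *\<^sub>v v) $ k \<noteq> 0"
    using Y by (metis carrier_matD(1) dim_mult_mat_vec eq_vecI index_zero_vec)
  show "\<sigma> * q v > 0"
    unfolding eq
  proof (rule sum_pos2[of _ k])
    fix i assume "i \<in> {..<n}"
    then show "\<sigma> * d i * (cmod ((Y *\<^sub>v v) $ i))\<^sup>2 \<ge> 0"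
      using pos by (cases "(Y *\<^sub>v v) $ i = 0") (auto intro: mult_nonneg_nonneg less_imp_le)
  qed (use k pos in auto)
qed (rule Y)

section \<open>Diagonalization of Hermitian matrices\<close>

lemma hermitian_form_eq_sum:
  assumes "A \<in> carrier_mat n n" "v \<in> carrier_vec n"
  shows "hermitian_form A v = Re (\<Sum>i<n. \<Sum>j<n. A $$ (i, j) * v $ j * cnj (v $ i))"
  using assms by (simp add: hermitian_form_def scalar_prod_def sum_distrib_right atLeast0LessThan)

lemma order_prod_linear_factors:
  "order a (\<Prod>b\<leftarrow>bs. [:- b, 1:]) = count_list bs (a :: 'a :: idom)"
proof (induction bs)
  case (Cons b bs)
  let ?p = "\<Prod>b\<leftarrow>bs. [:- b, 1:]"
  have nz: "[:- b, 1:] * ?p \<noteq> 0"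
    unfolding mult_eq_0_iff prod_list_zero_iff by auto
  have "order a [:- b, 1:] = (if b = a then 1 else 0)"
    using order_power_n_n[of a 1] by (auto intro: order_0I)
  then have "order a ([:- b, 1:] * ?p) = (if b = a then 1 else 0) + count_list bs a"
    unfolding order_mult[OF nz] Cons.IH by simp
  then show ?case unfolding list.map prod_list.Cons by simp
qed simp

text \<open>
  The order of a root counts its occurrences in a list of linear factors, which makes the sums of
  orders in the definition of inertia lengths of filtered lists.
\<close>

lemma sum_order_char_poly:
  fixes A :: "'a :: field mat"
  assumes A: "A \<in> carrier_mat n n" and cp: "char_poly A = (\<Prod>a\<leftarrow>as. [:- a, 1:])"
  shows "(\<Sum>a | eigenvalue A a \<and> R a. order a (char_poly A)) = length (filter R as)"
proof -
  have "{a. eigenvalue A a \<and> R a} = set (filter R as)"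
    unfolding eigenvalue_root_char_poly[OF A] cp by (auto simp: poly_prod_list prod_list_zero_iff)
  moreover have "order a (char_poly A) = count_list (filter R as) a" if "R a" for a
    unfolding cp order_prod_linear_factors using that by (induction as) auto
  ultimately have "(\<Sum>a | eigenvalue A a \<and> R a. order a (char_poly A))
      = (\<Sum>a\<in>set (filter R as). count_list (filter R as) a)"
    by (intro sum.cong) auto
  then show ?thesis by (simp add: sum_count_set)
qed

lemma jordan_matrix_entry:
  assumes "i < sum_list (map fst n_as)" "j < sum_list (map fst n_as)"
    "jordan_matrix n_as $$ (i, j) \<noteq> 0" "i \<noteq> j"
  shows "j = Suc i \<and> jordan_matrix n_as $$ (i, j) = 1 \<and>
         jordan_matrix n_as $$ (i, i) = jordan_matrix n_as $$ (j, j)"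
  using assms
proof (induction n_as arbitrary: i j)
  case (Cons p n_as)
  obtain k a where p: "p = (k, a)" by fastforce
  let ?J = "jordan_matrix n_as" and ?s = "sum_list (map fst n_as)"
  have entry: "jordan_matrix (p # n_as) $$ (i, j) =
      (if i < k then if j < k then jordan_block k a $$ (i, j) else 0
       else if j < k then 0 else ?J $$ (i - k, j - k))" if "i < k + ?s" "j < k + ?s" for i j
    using that unfolding p jordan_matrix_Cons by simp
  have lt: "i < k + ?s" "j < k + ?s" using Cons.prems p by simp_all
  consider "i < k" "j < k" | "\<not> i < k" "\<not> j < k"
    using Cons.prems(3) unfolding entry[OF lt] by (auto split: if_splits)
  then show ?case
  proof cases
    case 1
    then show ?thesis using Cons.prems(3,4) lt by (simp add: entry split: if_splits)
  next
    case 2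
    have "i - k < ?s" "j - k < ?s" "i - k \<noteq> j - k" using 2 lt Cons.prems(4) by auto
    moreover have "?J $$ (i - k, j - k) \<noteq> 0" using Cons.prems(3) 2 by (simp add: entry lt)
    ultimately have IH: "j - k = Suc (i - k)" "?J $$ (i - k, j - k) = 1"
        "?J $$ (i - k, i - k) = ?J $$ (j - k, j - k)"
      using Cons.IH[of "i - k" "j - k"] by blast+
    have "j = Suc i" using IH(1) 2 by linarith
    then show ?thesis
      using IH(2,3) entry[OF lt] entry[OF lt(1,1)] entry[OF lt(2,2)] 2 by argo
  qed
qed simp

lemma mult_inverse_vec:
  fixes P :: "'a :: semiring_1 mat"
  assumes "P \<in> carrier_mat n n" "Q \<in> carrier_mat n n" "P * Q = 1\<^sub>m n" "v \<in> carrier_vec n"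
  shows "P *\<^sub>v (Q *\<^sub>v v) = v"
  using assoc_mult_mat_vec[OF assms(1,2,4)] one_mult_mat_vec[OF assms(4)] assms(3) by simp

lemma mult_mat_vec_zero:
  fixes A :: "'a :: semiring_1 mat"
  assumes "A \<in> carrier_mat n n"
  shows "A *\<^sub>v 0\<^sub>v n = 0\<^sub>v n"
proof (rule eq_vecI)
  fix i assume "i < dim_vec (0\<^sub>v n :: 'a vec)"
  then show "(A *\<^sub>v 0\<^sub>v n) $ i = 0\<^sub>v n $ i" using assms by simp
qed (use assms in simp)

lemma hermitian_sprod:
  assumes A: "A \<in> carrier_mat n n" and herm: "hermitian_mat A"
    and x: "x \<in> carrier_vec n" and y: "y \<in> carrier_vec n"
  shows "(A *\<^sub>v x) \<bullet>c y = x \<bullet>c (A *\<^sub>v y)"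
proof -
  have "(A *\<^sub>v x) \<bullet>c y = (\<Sum>i<n. \<Sum>j<n. A $$ (i, j) * x $ j * cnj (y $ i))"
    using A x y by (simp add: scalar_prod_def sum_distrib_right atLeast0LessThan)
  also have "\<dots> = (\<Sum>j<n. \<Sum>i<n. A $$ (i, j) * x $ j * cnj (y $ i))"
    by (rule sum.swap)
  also have "\<dots> = (\<Sum>j<n. \<Sum>i<n. x $ j * (cnj (A $$ (j, i)) * cnj (y $ i)))"
  proof (intro sum.cong refl)
    fix i j assume "j \<in> {..<n}" "i \<in> {..<n}"
    then have "A $$ (i, j) = cnj (A $$ (j, i))"
      using herm unfolding hermitian_mat_def carrier_matD(1)[OF A] by blast
    then show "A $$ (i, j) * x $ j * cnj (y $ i) = x $ j * (cnj (A $$ (j, i)) * cnj (y $ i))"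
      by (simp only: mult_ac)
  qed
  also have "\<dots> = x \<bullet>c (A *\<^sub>v y)"
    using A x y by (simp add: scalar_prod_def sum_distrib_left atLeast0LessThan)
  finally show ?thesis .
qed

lemma mult_mat_vec_sprod:
  fixes P :: "complex mat"
  assumes P: "P \<in> carrier_mat n n" and x: "x \<in> carrier_vec n" and y: "y \<in> carrier_vec n"
  shows "(P *\<^sub>v x) \<bullet>c (P *\<^sub>v y)
         = (\<Sum>i<n. \<Sum>j<n. x $ i * cnj (y $ j) * (col P i \<bullet>c col P j))"
proof -
  have "(P *\<^sub>v x) \<bullet>c (P *\<^sub>v y)
      = (\<Sum>k<n. (\<Sum>i<n. P $$ (k, i) * x $ i) * (\<Sum>j<n. cnj (P $$ (k, j)) * cnj (y $ j)))"
    using P x y by (simp add: scalar_prod_def atLeast0LessThan)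
  also have "\<dots> = (\<Sum>k<n. \<Sum>i<n. \<Sum>j<n. x $ i * cnj (y $ j) * (P $$ (k, i) * cnj (P $$ (k, j))))"
    by (simp add: sum_product mult_ac)
  also have "\<dots> = (\<Sum>i<n. \<Sum>k<n. \<Sum>j<n. x $ i * cnj (y $ j) * (P $$ (k, i) * cnj (P $$ (k, j))))"
    by (rule sum.swap)
  also have "\<dots> = (\<Sum>i<n. \<Sum>j<n. \<Sum>k<n. x $ i * cnj (y $ j) * (P $$ (k, i) * cnj (P $$ (k, j))))"
    by (intro sum.cong refl sum.swap)
  also have "\<dots> = (\<Sum>i<n. \<Sum>j<n. x $ i * cnj (y $ j) * (col P i \<bullet>c col P j))"
    using P by (intro sum.cong refl)
      (simp add: scalar_prod_def sum_distrib_left atLeast0LessThan)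
  finally show ?thesis .
qed

lemma hermitian_eigenvalue_real:
  assumes A: "A \<in> carrier_mat n n" "hermitian_mat A"
    and u: "u \<in> carrier_vec n" "u \<noteq> 0\<^sub>v n" "A *\<^sub>v u = c \<cdot>\<^sub>v u"
  shows "cnj c = c"
proof -
  have "c * (u \<bullet>c u) = cnj c * (u \<bullet>c u)"
    using hermitian_sprod[OF A u(1) u(1)] u by (simp add: conjugate_smult_vec)
  moreover have "u \<bullet>c u \<noteq> 0" using u conjugate_square_eq_0_vec by blast
  ultimately show ?thesis by simp
qed

text \<open>
  A chain of length two would give \<open>\<langle>A w, u\<rangle> = c \<langle>w, u\<rangle> + \<langle>u, u\<rangle>\<close> and
  \<open>\<langle>w, A u\<rangle> = c \<langle>w, u\<rangle>\<close>, where \<open>c\<close> is real as an eigenvalue; hence \<open>\<langle>u, u\<rangle> = 0\<close>.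
\<close>

lemma hermitian_no_jordan_chain:
  assumes A: "A \<in> carrier_mat n n" "hermitian_mat A"
    and u: "u \<in> carrier_vec n" "A *\<^sub>v u = c \<cdot>\<^sub>v u"
    and w: "w \<in> carrier_vec n" "A *\<^sub>v w = c \<cdot>\<^sub>v w + u"
  shows "u = 0\<^sub>v n"
proof (rule ccontr)
  assume u0: "u \<noteq> 0\<^sub>v n"
  have "c * (w \<bullet>c u) + u \<bullet>c u = cnj c * (w \<bullet>c u)"
    using hermitian_sprod[OF A w(1) u(1)] u w
    by (simp add: conjugate_smult_vec add_scalar_prod_distrib[of _ n])
  then have "u \<bullet>c u = 0" using hermitian_eigenvalue_real[OF A u(1) u0 u(2)] by simp
  then show False using u(1) u0 conjugate_square_eq_0_vec by blast
qed

text \<open>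
  The first nonzero entry above the diagonal would start a Jordan chain of length two.
\<close>

lemma hermitian_jordan_matrix_diagonal:
  assumes A: "A \<in> carrier_mat n n" "hermitian_mat A"
    and sim: "similar_mat_wit A (jordan_matrix n_as) P Q"
    and ij: "i < n" "j < n" "i \<noteq> j"
  shows "jordan_matrix n_as $$ (i, j) = 0"
proof (rule ccontr)
  let ?J = "jordan_matrix n_as"
  assume nz: "?J $$ (i, j) \<noteq> 0"
  note wit = similar_mat_witD2[OF A(1) sim]
  have size: "sum_list (map fst n_as) = n" using wit(5) by auto
  note entry = jordan_matrix_entry[of _ n_as, unfolded size]
  \<comment> \<open>Minimality makes the entry above position \<open>(k, k)\<close> zero, so column \<open>k\<close> is a true eigenvector.\<close>
  define k where "k = (LEAST k. Suc k < n \<and> ?J $$ (k, Suc k) \<noteq> 0)"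
  have ex: "Suc i < n \<and> ?J $$ (i, Suc i) \<noteq> 0" using entry[OF ij(1,2) nz ij(3)] ij nz by auto
  then have k: "Suc k < n" "?J $$ (k, Suc k) \<noteq> 0"
    unfolding k_def using LeastI[of "\<lambda>k. Suc k < n \<and> ?J $$ (k, Suc k) \<noteq> 0"] by blast+
  have least: "?J $$ (l, Suc l) = 0" if "l < k" for l
    using not_less_Least[OF that[unfolded k_def]] that k(1) by auto
  have chain: "?J $$ (k, Suc k) = 1" "?J $$ (Suc k, Suc k) = ?J $$ (k, k)"
    using entry[of k "Suc k"] k by auto
  let ?c = "?J $$ (k, k)"
  have off: "?J $$ (l, m) = 0" if "l < n" "m < n" "l \<noteq> m" "m \<noteq> Suc l" for l m
    using entry[of l m] that by blast
  have col_k: "col ?J k = ?c \<cdot>\<^sub>v unit_vec n k"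
  proof (rule eq_vecI)
    fix l assume "l < dim_vec (?c \<cdot>\<^sub>v unit_vec n k)"
    then have l: "l < n" by simp
    have "?J $$ (l, k) = 0" if "l \<noteq> k"
      using off[OF l _ that] least[of l] k(1) by (cases "k = Suc l") auto
    then show "col ?J k $ l = (?c \<cdot>\<^sub>v unit_vec n k) $ l"
      using l k(1) size by (cases "l = k") auto
  qed (use size in simp)
  have col_Suc: "col ?J (Suc k) = ?c \<cdot>\<^sub>v unit_vec n (Suc k) + unit_vec n k"
  proof (rule eq_vecI)
    fix l assume "l < dim_vec (?c \<cdot>\<^sub>v unit_vec n (Suc k) + unit_vec n k)"
    then have l: "l < n" by simp
    have "?J $$ (l, Suc k) = 0" if "l \<noteq> k" "l \<noteq> Suc k"
      using off[OF l k(1)] that by auto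
    then show "col ?J (Suc k) $ l = (?c \<cdot>\<^sub>v unit_vec n (Suc k) + unit_vec n k) $ l"
      using l k(1) size chain by (cases "l = k"; cases "l = Suc k") auto
  qed (use size in simp)
  have "A * P = P * ?J * (Q * P)"
    unfolding wit(3) using wit by (simp add: assoc_mult_mat[of _ n n _ n _ n])
  then have AP: "A * P = P * ?J"
    unfolding wit(2) using right_mult_one_mat[OF mult_carrier_mat[OF wit(6,5)]] by simp
  have A_col: "A *\<^sub>v col P l = P *\<^sub>v col ?J l" if "l < n" for l
    using col_mult2[OF wit(4,6) that] col_mult2[OF wit(6,5) that] AP by simp
  have P_unit: "P *\<^sub>v unit_vec n l = col P l" if "l < n" for l
    using wit(6) that by (intro eq_vecI) (auto simp: scalar_prod_right_unit)
  have "col P k = 0\<^sub>v n"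
  proof (rule hermitian_no_jordan_chain[OF A])
    show "A *\<^sub>v col P k = ?c \<cdot>\<^sub>v col P k"
      using k(1) wit(6) by (simp add: A_col col_k mult_mat_vec[of _ n n] P_unit)
    show "A *\<^sub>v col P (Suc k) = ?c \<cdot>\<^sub>v col P (Suc k) + col P k"
      using k(1) wit(6)
      by (simp add: A_col col_Suc mult_add_distrib_mat_vec[of _ n n] mult_mat_vec[of _ n n] P_unit)
  qed (use wit(6) k(1) in auto)
  moreover have "Q *\<^sub>v col P k = unit_vec n k"
    using col_mult2[OF wit(7,6), of k] k(1) wit(2) by simp
  ultimately have "unit_vec n k = (0\<^sub>v n :: complex vec)"
    using mult_mat_vec_zero[OF wit(7)] by simp
  then show False using k(1) by (metis Suc_lessD index_unit_vec(2) index_zero_vec(1) zero_neq_one)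
qed

lemma hermitian_diagonalization:
  assumes A: "A \<in> carrier_mat n n" "hermitian_mat A"
  obtains P Q d where "P \<in> carrier_mat n n" "Q \<in> carrier_mat n n"
    "P * Q = 1\<^sub>m n" "Q * P = 1\<^sub>m n"
    "\<forall>c\<in>carrier_vec n.
       A *\<^sub>v (P *\<^sub>v c) = P *\<^sub>v vec n (\<lambda>i. complex_of_real (d i) * c $ i)"
    "char_poly A = (\<Prod>a\<leftarrow>map (\<lambda>i. complex_of_real (d i)) [0..<n]. [:- a, 1:])"
proof -
  obtain as where "char_poly A = (\<Prod>a\<leftarrow>as. [:- a, 1:])"
    using char_poly_factorized[OF A(1)] by blast
  then obtain n_as where "jordan_nf A n_as" using jordan_nf_exists[OF A(1)] by blast
  then obtain P Q where sim: "similar_mat_wit A (jordan_matrix n_as) P Q"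
    unfolding jordan_nf_def similar_mat_def by blast
  let ?J = "jordan_matrix n_as"
  note wit = similar_mat_witD2[OF A(1) sim]
  note diag = hermitian_jordan_matrix_diagonal[OF A sim]
  have JV: "?J *\<^sub>v c = vec n (\<lambda>i. ?J $$ (i, i) * c $ i)" if c: "c \<in> carrier_vec n" for c
  proof (rule eq_vecI)
    fix i assume "i < dim_vec (vec n (\<lambda>i. ?J $$ (i, i) * c $ i))"
    then have i: "i < n" by simp
    have "(?J *\<^sub>v c) $ i = (\<Sum>j<n. ?J $$ (i, j) * c $ j)"
      using wit(5) c i by (auto simp: scalar_prod_def atLeast0LessThan)
    also have "\<dots> = (\<Sum>j\<in>{i}. ?J $$ (i, j) * c $ j)"
      using i diag by (intro sum.mono_neutral_right) auto
    finally show "(?J *\<^sub>v c) $ i = vec n (\<lambda>i. ?J $$ (i, i) * c $ i) $ i" using i by simp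
  qed (use wit(5) in auto)
  have mult: "A *\<^sub>v (P *\<^sub>v c) = P *\<^sub>v vec n (\<lambda>i. ?J $$ (i, i) * c $ i)"
    if c: "c \<in> carrier_vec n" for c
  proof -
    have "Q *\<^sub>v (P *\<^sub>v c) = c"
      using mult_inverse_vec[OF wit(7,6,2)] c by simp
    then have "A *\<^sub>v (P *\<^sub>v c) = P *\<^sub>v (?J *\<^sub>v c)"
      unfolding wit(3) using wit c by (simp add: assoc_mult_mat_vec[of _ n n _ n])
    then show ?thesis using JV[OF c] by simp
  qed
  have real: "cnj (?J $$ (i, i)) = ?J $$ (i, i)" if i: "i < n" for i
  proof (rule hermitian_eigenvalue_real[OF A])
    let ?u = "P *\<^sub>v unit_vec n i"
    show "?u \<in> carrier_vec n" using wit(6) by auto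
    have Qu: "Q *\<^sub>v ?u = unit_vec n i"
      using mult_inverse_vec[OF wit(7,6,2)] by simp
    have "unit_vec n i \<noteq> (0\<^sub>v n :: complex vec)"
      using i by (metis index_unit_vec(2) index_zero_vec(1) zero_neq_one)
    then show "?u \<noteq> 0\<^sub>v n" using Qu wit(7) by (metis mult_mat_vec_zero)
    have "vec n (\<lambda>l. ?J $$ (l, l) * unit_vec n i $ l) = ?J $$ (i, i) \<cdot>\<^sub>v unit_vec n i"
      using i by (intro eq_vecI) auto
    then show "A *\<^sub>v ?u = ?J $$ (i, i) \<cdot>\<^sub>v ?u"
      using mult[of "unit_vec n i"] wit(6) by (simp add: mult_mat_vec[of _ n n])
  qed
  have cp: "char_poly A = (\<Prod>a\<leftarrow>diag_mat ?J. [:- a, 1:])"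
  proof -
    have "upper_triangular ?J" using diag wit(5) by (auto simp: upper_triangular_def)
    then have "char_poly ?J = (\<Prod>a\<leftarrow>diag_mat ?J. [:- a, 1:])"
      by (rule char_poly_upper_triangular[OF wit(5)])
    moreover have "similar_mat A ?J" using sim similar_mat_def by blast
    ultimately show ?thesis using char_poly_similar by metis
  qed
  define d where "d i = Re (?J $$ (i, i))" for i
  have d: "complex_of_real (d i) = ?J $$ (i, i)" if "i < n" for i
    using real[OF that] by (simp add: d_def complex_eq_iff)
  have "diag_mat ?J = map (\<lambda>i. complex_of_real (d i)) [0..<n]"
    using wit(5) by (auto simp: diag_mat_def d)
  moreover have "vec n (\<lambda>i. ?J $$ (i, i) * c $ i) = vec n (\<lambda>i. complex_of_real (d i) * c $ i)" for c
    by (intro eq_vecI) (auto simp: d)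
  ultimately show thesis
    using that[of P Q d] wit mult cp by simp
qed

section \<open>Sylvester's law of inertia\<close>

text \<open>
  The columns \<open>p\<^sub>i\<close> of \<open>P\<close> are eigenvectors, not necessarily orthogonal within an eigenspace. Let
  \<open>c = Q v\<close>, so \<open>v = P c\<close> and \<open>\<langle>A v, v\<rangle> = \<Sum>i j. d i * c\<^sub>i * cnj c\<^sub>j * \<langle>p\<^sub>i, p\<^sub>j\<rangle>\<close>. As
  \<open>\<langle>p\<^sub>i, p\<^sub>j\<rangle> = 0\<close> unless \<open>d i = d j\<close>, the factor \<open>d i\<close> can be replaced by \<open>sqrt (d i) * sqrt (d j)\<close>
  term by term if \<open>d\<close> is nonnegative wherever \<open>c\<close> does not vanish. The form is then the squared norm of
  \<open>P x\<close> with \<open>x\<^sub>i = sqrt (d i) * c\<^sub>i\<close>, and \<open>P\<close> is injective. The factor \<open>\<sigma>\<close> covers negative \<open>d\<close>.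
\<close>

lemma sign_coords_diagonalization:
  assumes A: "A \<in> carrier_mat n n" "hermitian_mat A"
    and P: "P \<in> carrier_mat n n" and Q: "Q \<in> carrier_mat n n"
    and PQ: "P * Q = 1\<^sub>m n" and QP: "Q * P = 1\<^sub>m n"
    and AP: "\<And>c. c \<in> carrier_vec n \<Longrightarrow>
       A *\<^sub>v (P *\<^sub>v c) = P *\<^sub>v vec n (\<lambda>i. complex_of_real (d i) * c $ i)"
  shows "sign_coords n (hermitian_form A) Q d"
proof -
  have col_eigen: "A *\<^sub>v col P i = complex_of_real (d i) \<cdot>\<^sub>v col P i" if i: "i < n" for i
  proof -
    have "P *\<^sub>v unit_vec n i = col P i"
      using P i by (intro eq_vecI) (auto simp: scalar_prod_right_unit)
    moreover have "vec n (\<lambda>l. complex_of_real (d l) * unit_vec n i $ l)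
        = complex_of_real (d i) \<cdot>\<^sub>v unit_vec n i"
      using i by (intro eq_vecI) auto
    ultimately show ?thesis using AP[of "unit_vec n i"] P by (simp add: mult_mat_vec[of _ n n])
  qed
  have orth: "col P i \<bullet>c col P j = 0" if "i < n" "j < n" "d i \<noteq> d j" for i j
  proof -
    have "complex_of_real (d i) * (col P i \<bullet>c col P j) = complex_of_real (d j) * (col P i \<bullet>c col P j)"
      using hermitian_sprod[OF A, of "col P i" "col P j"] that P
      by (simp add: col_eigen conjugate_smult_vec)
    then show ?thesis using that(3) by simp
  qed
  have form: "\<sigma> * hermitian_form A v = Re ((P *\<^sub>v x) \<bullet>c (P *\<^sub>v x))"
    if v: "v \<in> carrier_vec n" and \<sigma>: "\<forall>i<n. (Q *\<^sub>v v) $ i \<noteq> 0 \<longrightarrow> \<sigma> * d i \<ge> 0"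
      and x: "x = vec n (\<lambda>i. complex_of_real (sqrt (\<sigma> * d i)) * (Q *\<^sub>v v) $ i)" for \<sigma> v x
  proof -
    define c where "c = Q *\<^sub>v v"
    have c: "c \<in> carrier_vec n" using Q v by (auto simp: c_def)
    have Pc: "v = P *\<^sub>v c"
      unfolding c_def using mult_inverse_vec[OF P Q PQ v] by simp
    have "complex_of_real \<sigma> * ((A *\<^sub>v v) \<bullet>c v)
        = (\<Sum>i<n. \<Sum>j<n. complex_of_real (\<sigma> * d i) * c $ i * cnj (c $ j) * (col P i \<bullet>c col P j))"
      unfolding Pc AP[OF c] using c
      by (subst mult_mat_vec_sprod[OF P]) (auto simp: sum_distrib_left mult_ac intro!: sum.cong)
    also have "\<dots> = (\<Sum>i<n. \<Sum>j<n. x $ i * cnj (x $ j) * (col P i \<bullet>c col P j))"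
    proof (intro sum.cong refl)
      fix i j assume "i \<in> {..<n}" "j \<in> {..<n}"
      then have ij: "i < n" "j < n" by auto
      show "complex_of_real (\<sigma> * d i) * c $ i * cnj (c $ j) * (col P i \<bullet>c col P j)
          = x $ i * cnj (x $ j) * (col P i \<bullet>c col P j)"
      proof (cases "c $ i = 0 \<or> d i \<noteq> d j")
        case True
        then show ?thesis using orth[OF ij] ij by (auto simp: x c_def)
      next
        case False
        \<comment> \<open>This is the step that needs \<open>d i = d j\<close>: the two square roots multiply to \<open>\<sigma> * d i\<close>.\<close>
        then have "\<sigma> * d i \<ge> 0" "d j = d i" using \<sigma> ij by (auto simp: c_def)
        then have "complex_of_real (\<sigma> * d i)
            = complex_of_real (sqrt (\<sigma> * d i)) * complex_of_real (sqrt (\<sigma> * d j))"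
          by (simp flip: of_real_mult)
        then show ?thesis using ij by (simp add: x c_def[symmetric] mult_ac)
      qed
    qed
    also have "\<dots> = (P *\<^sub>v x) \<bullet>c (P *\<^sub>v x)"
      by (rule mult_mat_vec_sprod[OF P, symmetric]) (simp_all add: x)
    finally have "Re (complex_of_real \<sigma> * ((A *\<^sub>v v) \<bullet>c v)) = Re ((P *\<^sub>v x) \<bullet>c (P *\<^sub>v x))" by simp
    then show ?thesis by (simp add: hermitian_form_def)
  qed
  have sprod: "y \<bullet>c y = complex_of_real (\<Sum>i<n. (cmod (y $ i))\<^sup>2)" if "y \<in> carrier_vec n" for y
    using that unfolding of_real_sum complex_norm_square
    by (simp add: scalar_prod_def atLeast0LessThan)
  show ?thesis
    unfolding sign_coords_def
  proof (intro conjI ballI impI)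
    fix \<sigma> :: real and v :: "complex vec"
    assume v: "v \<in> carrier_vec n" "v \<noteq> 0\<^sub>v n"
    let ?x = "vec n (\<lambda>i. complex_of_real (sqrt (\<sigma> * d i)) * (Q *\<^sub>v v) $ i)"
    have Px: "P *\<^sub>v ?x \<in> carrier_vec n" using P by auto
    show nonneg: "\<sigma> * hermitian_form A v \<ge> 0" if "\<forall>i<n. (Q *\<^sub>v v) $ i \<noteq> 0 \<longrightarrow> \<sigma> * d i \<ge> 0"
      unfolding form[OF v(1) that refl] sprod[OF Px] by (simp add: sum_nonneg)
    assume pos: "\<forall>i<n. (Q *\<^sub>v v) $ i \<noteq> 0 \<longrightarrow> \<sigma> * d i > 0"
    then have ge: "\<forall>i<n. (Q *\<^sub>v v) $ i \<noteq> 0 \<longrightarrow> \<sigma> * d i \<ge> 0" by force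
    have "v = P *\<^sub>v (Q *\<^sub>v v)"
      using mult_inverse_vec[OF P Q PQ v(1)] by simp
    then have "Q *\<^sub>v v \<noteq> 0\<^sub>v n" using v(2) P by auto
    then obtain k where k: "k < n" "(Q *\<^sub>v v) $ k \<noteq> 0"
      using Q by (metis carrier_matD(1) dim_mult_mat_vec eq_vecI index_zero_vec)
    then have "?x $ k \<noteq> 0" using pos by force
    then have "?x \<noteq> 0\<^sub>v n" using k(1) by (metis index_zero_vec(1))
    moreover have "?x = Q *\<^sub>v (P *\<^sub>v ?x)"
      using mult_inverse_vec[OF Q P QP] by simp
    ultimately have "P *\<^sub>v ?x \<noteq> 0\<^sub>v n" using Q by (metis mult_mat_vec_zero)
    then have "(P *\<^sub>v ?x) \<bullet>c (P *\<^sub>v ?x) \<noteq> 0" using Px conjugate_square_eq_0_vec by blast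
    then have "\<sigma> * hermitian_form A v \<noteq> 0"
      unfolding form[OF v(1) ge refl] sprod[OF Px] Re_complex_of_real of_real_eq_0_iff .
    then show "\<sigma> * hermitian_form A v > 0" using nonneg[OF ge] by (metis order_le_less)
  qed (rule Q)
qed

text \<open>
  The eigenvector coordinates carry the eigenvalues, with their multiplicities in the characteristic
  polynomial, as coefficients; comparing them with the given coordinates \<open>Y\<close> yields the counts.
\<close>

lemma sylvester_inertia:
  assumes A: "A \<in> carrier_mat n n" "hermitian_mat A"
    and Y: "sign_coords n (hermitian_form A) Y e"
  shows "i_plus A = card {i. i < n \<and> e i > 0}"
    and "i_minus A = card {i. i < n \<and> e i < 0}"
    and "i_zero A = card {i. i < n \<and> e i = 0}"
proof -
  obtain P Q d where PQ: "P \<in> carrier_mat n n" "Q \<in> carrier_mat n n"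
    "P * Q = 1\<^sub>m n" "Q * P = 1\<^sub>m n"
    and AP: "\<forall>c\<in>carrier_vec n.
       A *\<^sub>v (P *\<^sub>v c) = P *\<^sub>v vec n (\<lambda>i. complex_of_real (d i) * c $ i)"
    and cp: "char_poly A = (\<Prod>a\<leftarrow>map (\<lambda>i. complex_of_real (d i)) [0..<n]. [:- a, 1:])"
    using hermitian_diagonalization[OF A] by blast
  note eq = sign_coords_card_eq[OF sign_coords_diagonalization[OF A PQ bspec[OF AP]] Y]
  have count: "length (filter R (map (\<lambda>i. complex_of_real (d i)) [0..<n]))
      = card {i. i < n \<and> R (complex_of_real (d i))}" for R
    unfolding length_filter_conv_card by (rule arg_cong[where f = card]) auto
  note inertia = sum_order_char_poly[OF A(1) cp, unfolded count]
  show "i_plus A = card {i. i < n \<and> e i > 0}"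
    unfolding i_plus_def inertia by (simp add: eq)
  show "i_minus A = card {i. i < n \<and> e i < 0}"
    unfolding i_minus_def inertia by (simp add: eq)
  show "i_zero A = card {i. i < n \<and> e i = 0}"
    unfolding i_zero_def inertia by (simp add: eq)
qed

section \<open>Inertia of power GCD and LCM matrices\<close>

lemma lcm_powr_neg:
  fixes a b :: nat
  assumes "a > 0" "b > 0"
  shows "real (lcm a b) powr (- m) = real (gcd a b) powr m * real a powr (- m) * real b powr (- m)"
proof -
  have "real (gcd a b) powr (- m) * real (lcm a b) powr (- m) = real a powr (- m) * real b powr (- m)"
    using prod_gcd_lcm_nat[of a b] by (metis of_nat_0_le_iff of_nat_mult powr_mult)
  moreover have "real (gcd a b) powr m * real (gcd a b) powr (- m) = 1"
    using assms by (simp flip: powr_add)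
  ultimately show ?thesis by (metis mult.assoc mult_1)
qed

lemma hermitian_form_lcm_matrix_pos:
  fixes f :: "nat \<Rightarrow> complex"
  assumes "m > 0"
    and f: "\<And>k. k > 0 \<Longrightarrow> f k = complex_of_real (real k powr (- m))"
    and xs: "distinct xs" "\<forall>x\<in>set xs. x > 0"
    and v: "v \<in> carrier_vec (length xs)" "v \<noteq> 0\<^sub>v (length xs)"
  shows "hermitian_form (lcm_matrix f xs) v > 0"
proof -
  let ?n = "length xs"
  \<comment> \<open>The factors \<open>a\<^sup>-\<^sup>m\<close> and \<open>b\<^sup>-\<^sup>m\<close> of the entry are absorbed into the variables.\<close>
  define w where "w i = complex_of_real (real (xs ! i) powr (- m)) * v $ i" for i
  define D where "D = (\<Union>x\<in>set xs. {d. d dvd x})"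
  define s where "s d = (\<Sum>i | i < ?n \<and> d dvd xs ! i. w i)" for d
  have pos: "xs ! i > 0" if "i < ?n" for i using xs(2) that by simp
  have D: "finite D" "\<And>d. d \<in> D \<Longrightarrow> d > 0"
    unfolding D_def using xs(2) dvd_pos_nat by auto
  have entry: "lcm_matrix f xs $$ (i, j) * v $ j * cnj (v $ i)
      = of_real (\<Sum>d | d dvd gcd (xs ! i) (xs ! j). jordan_totient m d) * w j * cnj (w i)"
    if "i < ?n" "j < ?n" for i j
  proof -
    have "(\<Sum>d | d dvd gcd (xs ! i) (xs ! j). jordan_totient m d) = real (gcd (xs ! i) (xs ! j)) powr m"
      using pos that by (intro sum_jordan_totient_divisors) simp
    moreover have "lcm_matrix f xs $$ (i, j) = complex_of_real (real (lcm (xs ! i) (xs ! j)) powr (- m))"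
      using that pos by (simp add: lcm_matrix_def f lcm_pos_nat)
    ultimately show ?thesis
      by (simp add: lcm_powr_neg[OF pos[OF that(1)] pos[OF that(2)]] w_def)
  qed
  have carrier: "lcm_matrix f xs \<in> carrier_mat ?n ?n" by (simp add: lcm_matrix_def)
  have "hermitian_form (lcm_matrix f xs) v = Re (\<Sum>i<?n. \<Sum>j<?n.
      of_real (\<Sum>d | d dvd gcd (xs ! i) (xs ! j). jordan_totient m d) * w j * cnj (w i))"
    unfolding hermitian_form_eq_sum[OF carrier v(1)]
    by (intro arg_cong[where f = Re] sum.cong refl entry) auto
  also have "\<dots> = (\<Sum>d\<in>D. jordan_totient m d * (cmod (s d))\<^sup>2)"
    unfolding s_def
    by (subst gcd_form_eq_sum_squares[OF D(1)]) (auto simp: D_def)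
  finally have form: "hermitian_form (lcm_matrix f xs) v = (\<Sum>d\<in>D. jordan_totient m d * (cmod (s d))\<^sup>2)" .
  obtain i where i: "i < ?n" "v $ i \<noteq> 0"
    using v by (metis carrier_vecD eq_vecI index_zero_vec)
  then have "w i \<noteq> 0" using pos by (simp add: w_def)
  then obtain k where k: "k < ?n" "s (xs ! k) \<noteq> 0"
    using divisor_sums_eq_0_imp[OF xs _ i(1), of w] unfolding s_def by blast
  show ?thesis
    unfolding form
  proof (rule sum_pos2[OF D(1)])
    show "xs ! k \<in> D" unfolding D_def by (rule UN_I[OF nth_mem[OF k(1)]]) simp
    show "jordan_totient m (xs ! k) * (cmod (s (xs ! k)))\<^sup>2 > 0"
      using k pos jordan_totient_pos[OF \<open>m > 0\<close>] by simp
    show "jordan_totient m d * (cmod (s d))\<^sup>2 \<ge> 0" if "d \<in> D" for d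
      using less_imp_le[OF jordan_totient_pos[OF \<open>m > 0\<close> D(2)[OF that]]] by simp
  qed
qed

text \<open>
  Over a factor-closed set the index \<open>d\<close> of the sum of squares runs through the set itself, so the
  divisor sums are as many as the variables and form a system of coordinates.
\<close>

lemma sign_coords_gcd_matrix:
  fixes f :: "nat \<Rightarrow> complex"
  assumes f: "\<And>k. k > 0 \<Longrightarrow> f k = complex_of_real (real k powr s)"
    and xs: "distinct xs" "\<forall>x\<in>set xs. x > 0"
    and closed: "factor_closed (set xs)"
  shows "sign_coords (length xs) (hermitian_form (gcd_matrix f xs))
           (mat (length xs) (length xs) (\<lambda>(k, i). if xs ! k dvd xs ! i then 1 else 0))
           (\<lambda>k. jordan_totient s (xs ! k))"
proof -
  let ?n = "length xs"
  let ?Y = "mat ?n ?n (\<lambda>(k, i). if xs ! k dvd xs ! i then 1 else 0 :: complex)"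
  have Yv: "(?Y *\<^sub>v v) $ k = (\<Sum>i | i < ?n \<and> xs ! k dvd xs ! i. v $ i)"
    if "v \<in> carrier_vec ?n" "k < ?n" for v k
  proof -
    have "(?Y *\<^sub>v v) $ k = (\<Sum>i<?n. if xs ! k dvd xs ! i then v $ i else 0)"
      using that by (auto simp: scalar_prod_def atLeast0LessThan intro!: sum.cong)
    then show ?thesis by (simp add: sum.inter_filter[symmetric])
  qed
  show ?thesis
  proof (rule sign_coords_sum_squares)
    fix v :: "complex vec"
    assume v: "v \<in> carrier_vec ?n"
    {
      assume 0: "?Y *\<^sub>v v = 0\<^sub>v ?n"
      have "v $ i = 0" if "i < ?n" for i
        using xs
      proof (rule divisor_sums_eq_0_imp)
        show "(\<Sum>i | i < ?n \<and> xs ! k dvd xs ! i. v $ i) = 0" if "k < ?n" for k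
          using Yv[OF v that] 0 that by simp
      qed (rule that)
      then show "v = 0\<^sub>v ?n" using v by (intro eq_vecI) auto
    }
    have entry: "gcd_matrix f xs $$ (i, j)
        = of_real (\<Sum>d | d dvd gcd (xs ! i) (xs ! j). jordan_totient s d)"
      if "i < ?n" "j < ?n" for i j
    proof -
      have gcd_pos: "gcd (xs ! i) (xs ! j) > 0" using xs(2) that by simp
      show ?thesis
        unfolding sum_jordan_totient_divisors[OF gcd_pos] using that gcd_pos
        by (simp add: gcd_matrix_def f del: gcd_pos_nat)
    qed
    have carrier: "gcd_matrix f xs \<in> carrier_mat ?n ?n" by (simp add: gcd_matrix_def)
    have "hermitian_form (gcd_matrix f xs) v = Re (\<Sum>i<?n. \<Sum>j<?n.
        of_real (\<Sum>d | d dvd gcd (xs ! i) (xs ! j). jordan_totient s d) * v $ j * cnj (v $ i))"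
      unfolding hermitian_form_eq_sum[OF carrier v]
      by (intro arg_cong[where f = Re] sum.cong refl) (simp add: entry)
    also have "\<dots> = (\<Sum>d\<in>set xs. jordan_totient s d * (cmod (\<Sum>i | i < ?n \<and> d dvd xs ! i. v $ i))\<^sup>2)"
    proof (subst gcd_form_eq_sum_squares[where D = "set xs"])
      fix x d assume "x \<in> set xs" "d dvd x"
      moreover from this have "d > 0" using xs(2) dvd_pos_nat by blast
      ultimately show "d \<in> set xs" using closed unfolding factor_closed_def by blast
    qed auto
    also have "\<dots> = (\<Sum>k<?n. jordan_totient s (xs ! k)
        * (cmod (\<Sum>i | i < ?n \<and> xs ! k dvd xs ! i. v $ i))\<^sup>2)"
      by (rule sum.reindex_bij_betw[OF bij_betw_nth[OF xs(1)], symmetric]) auto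
    also have "\<dots> = (\<Sum>k<?n. jordan_totient s (xs ! k) * (cmod ((?Y *\<^sub>v v) $ k))\<^sup>2)"
      by (intro sum.cong refl) (simp add: Yv[OF v] del: index_mult_mat_vec)
    finally show "hermitian_form (gcd_matrix f xs) v
        = (\<Sum>k<?n. jordan_totient s (xs ! k) * (cmod ((?Y *\<^sub>v v) $ k))\<^sup>2)" .
  qed simp
qed

lemma card_nth_eq_card_set:
  assumes "distinct xs"
  shows "card {k. k < length xs \<and> R (xs ! k)} = card {x \<in> set xs. R x}"
proof -
  have "bij_betw ((!) xs) {k. k < length xs \<and> R (xs ! k)} {x \<in> set xs. R x}"
    using assms by (auto simp: bij_betw_def inj_on_def nth_eq_iff_index_eq in_set_conv_nth)
  then show ?thesis by (rule bij_betw_same_card)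
qed

theorem theorem4p2:
  fixes m :: real and f :: "nat \<Rightarrow> complex" and xs :: "nat list" and n :: nat
  assumes "m > 0"
    and "\<And>k. k > 0 \<Longrightarrow> f k = complex_of_real (real k powr (- m))"
    and "distinct xs" and "length xs = n" and "\<forall>x\<in>set xs. x > 0"
  shows "(i_plus (lcm_matrix f xs) = n \<and> i_minus (lcm_matrix f xs) = 0 \<and>
          i_zero (lcm_matrix f xs) = 0) \<and>
         (factor_closed (set xs) \<longrightarrow>
          i_plus (gcd_matrix f xs) = card {x \<in> set xs. even (omega x)} \<and>
          i_minus (gcd_matrix f xs) = card {x \<in> set xs. odd (omega x)} \<and>
          i_zero (gcd_matrix f xs) = 0)"
proof (rule conjI; (rule impI)?)
  have carrier: "lcm_matrix f xs \<in> carrier_mat n n" "gcd_matrix f xs \<in> carrier_mat n n"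
    using assms(4) by (simp_all add: lcm_matrix_def gcd_matrix_def)
  have herm: "hermitian_mat (lcm_matrix f xs)" "hermitian_mat (gcd_matrix f xs)"
    using assms(2,5)
    by (simp_all add: hermitian_mat_def lcm_matrix_def gcd_matrix_def lcm_pos_nat
        gcd.commute lcm.commute)
  have "sign_coords n (hermitian_form (lcm_matrix f xs)) (1\<^sub>m n) (\<lambda>_. 1)"
    using hermitian_form_lcm_matrix_pos[OF assms(1,2,3,5)] assms(4) by (intro sign_coords_pos) auto
  from sylvester_inertia[OF carrier(1) herm(1) this]
  show "i_plus (lcm_matrix f xs) = n \<and> i_minus (lcm_matrix f xs) = 0 \<and>
      i_zero (lcm_matrix f xs) = 0"
    by simp
  assume "factor_closed (set xs)"
  note coords = sign_coords_gcd_matrix[OF assms(2,3,5) this, unfolded assms(4)]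
  note inertia = sylvester_inertia[OF carrier(2) herm(2) coords]
  have sgn: "sgn (jordan_totient (- m) x) = (- 1) ^ omega x" if "x \<in> set xs" for x
    using sgn_jordan_totient_neg[of "- m" x] assms(1,5) that by simp
  have iff: "jordan_totient (- m) x > 0 \<longleftrightarrow> even (omega x)"
    "jordan_totient (- m) x < 0 \<longleftrightarrow> odd (omega x)" "jordan_totient (- m) x \<noteq> 0"
    if "x \<in> set xs" for x
    using sgn[OF that] by (cases "even (omega x)"; auto simp: sgn_real_def split: if_splits)+
  note count = card_nth_eq_card_set[OF assms(3), unfolded assms(4)]
  have "card {k. k < n \<and> jordan_totient (- m) (xs ! k) > 0} = card {x \<in> set xs. even (omega x)}"
    unfolding count[of "\<lambda>x. jordan_totient (- m) x > 0"]
    by (rule arg_cong[where f = card]) (use iff in blast)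
  moreover have "card {k. k < n \<and> jordan_totient (- m) (xs ! k) < 0} = card {x \<in> set xs. odd (omega x)}"
    unfolding count[of "\<lambda>x. jordan_totient (- m) x < 0"]
    by (rule arg_cong[where f = card]) (use iff in blast)
  moreover have "{k. k < n \<and> jordan_totient (- m) (xs ! k) = 0} = {}"
    using iff(3) assms(4) nth_mem by blast
  ultimately show "i_plus (gcd_matrix f xs) = card {x \<in> set xs. even (omega x)} \<and>
      i_minus (gcd_matrix f xs) = card {x \<in> set xs. odd (omega x)} \<and>
      i_zero (gcd_matrix f xs) = 0"
    using inertia by simp
qed

end
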